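(* Let $T(z,w)=\sum_{n\ge1}\sum_{t\ge0}T(n,t)\,w^t z^n$. Let $C(x)=\frac{1-\sqrt{1-4x}}{2x}$, and define $\rho_0(z)=C(z(1-w))$ and, for $j\ge1$, $\rho_j(z)=C\!\left(z(1-w)\prod_{i=0}^{j-1}\rho_i(z)\right)$. Then $$T(z,w)=\sum_{j\ge0}(\rho_j(z)-1)\,w^j\prod_{i=0}^{j-1}\rho_i(z).$$
   Context: Multi-pass stack sorting: in a pass, the entries of the current input are pushed one at a time, in order, onto a stack; whenever the top of the stack is the smallest value not yet output, it is popped to the output (repeatedly); entries are never popped otherwise. When all input entries have been pushed and no pop is possible, if the stack is nonempty the remaining entries are returned to the input in their original relative order and a new pass begins. The tier of a permutation is one less than the minimum number of passes needed to output $1,\dots,n$. $T(n,t)$ denotes the number of permutations of length $n$ with tier $t$. $C(x)$ is the generating function of the Catalan numbers $\frac{1}{n+1}\binom{2n}{n}$ (a formal power series in $x$), and the identity is an identity of formal power series in $z$ and $w$. *)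

theory Defs
  imports
    "HOL-Computational_Algebra.Formal_Power_Series"
    "HOL-Combinatorics.Multiset_Permutations"
begin

(* The output is 1, 2, 3, ... in this order, so it is recorded by the single number m, the
   smallest value not yet output. Stacks are lists with the top at the head. *)

fun pop_all :: "nat list \<Rightarrow> nat \<Rightarrow> nat list \<times> nat" where
  "pop_all [] m = ([], m)"
| "pop_all (x # st) m = (if x = m then pop_all st (Suc m) else (x # st, m))"

fun push_all :: "nat list \<Rightarrow> nat list \<Rightarrow> nat \<Rightarrow> nat list \<times> nat" where
  "push_all [] st m = (st, m)"
| "push_all (x # xs) st m = (let (st', m') = pop_all (x # st) m in push_all xs st' m')"

definition sort_pass :: "nat list \<times> nat \<Rightarrow> nat list \<times> nat" where
  "sort_pass = (\<lambda>(xs, m). let (st, m') = push_all xs [] m in (filter (\<lambda>x. x \<in> set st) xs, m'))"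

definition passes_needed :: "nat list \<Rightarrow> nat" where
  "passes_needed p = (LEAST k. fst ((sort_pass ^^ k) (p, 1)) = [])"

(* At least one pass is needed for a nonempty permutation, so the subtraction does not truncate
   there. *)
definition tier :: "nat list \<Rightarrow> nat" where
  "tier p = passes_needed p - 1"

definition tier_count :: "nat \<Rightarrow> nat \<Rightarrow> nat" where
  "tier_count n t = card {p \<in> permutations_of_set {1..n}. tier p = t}"

(* Formal power series in z and w are elements of rat fps fps: the outer indeterminate is z, the
   coefficients are series in w. Infinite sums of such series are meant coefficientwise: for each n
   the coefficients of z^n are summed in rat fps, whose library topology is the w-adic one. The
   z-adic topology of rat fps fps itself is too fine for the sums considered here. *)

abbreviation var_z :: "rat fps fps" where
  "var_z \<equiv> fps_X"

abbreviation var_w :: "rat fps fps" where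
  "var_w \<equiv> fps_const fps_X"

definition tier_gf :: "rat fps fps" where
  "tier_gf = Abs_fps (\<lambda>n. if n \<ge> 1 then Abs_fps (\<lambda>t. of_nat (tier_count n t)) else 0)"

definition catalan_gf :: "rat fps" where
  "catalan_gf = Abs_fps (\<lambda>n. of_nat ((2 * n) choose n) / of_nat (n + 1))"

(* C(f) for a series f in z and w. The composition is the intended one if f has no term free
   of z. *)
definition catalan_subst :: "rat fps fps \<Rightarrow> rat fps fps" where
  "catalan_subst f = fps_compose (Abs_fps (\<lambda>n. fps_const (fps_nth catalan_gf n))) f"

(* For j = 0 the product is empty, so rho 0 = C(z(1 - w)). *)
fun rho :: "nat \<Rightarrow> rat fps fps" where
  "rho j = catalan_subst (var_z * (1 - var_w) * (\<Prod>i<j. rho i))"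

declare rho.simps [simp del]

lemma catalan_gf_Suc:
  "of_nat (n + 2) * fps_nth catalan_gf (Suc n) = 2 * of_nat (2 * n + 1) * fps_nth catalan_gf n"
proof -
  have 1: "Suc n * ((2 * n + 2) choose (n + 1)) = (2 * n + 2) * ((2 * n + 1) choose n)"
    using Suc_times_binomial[of n "2 * n + 1"] by simp
  have 2: "(n + 1) * ((2 * n + 1) choose n) = (2 * n + 1) * ((2 * n) choose n)"
    using Suc_times_binomial_add[of n n] Suc_times_binomial[of n "2 * n"]
      binomial_symmetric[of "n" "2 * n + 1"] by simp
  have "(n + 1) * ((n + 1) * ((2 * n + 2) choose (n + 1)))
      = (n + 1) * (2 * ((2 * n + 1) * ((2 * n) choose n)))"
    using 1 2 by (metis (no_types, lifting) Suc_eq_plus1 distrib_left_numeral mult.assoc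
        mult.commute mult.left_commute one_add_one mult_2_right mult_2 add_mult_distrib2 mult_1_right)
  hence "(n + 1) * ((2 * n + 2) choose (n + 1)) = 2 * ((2 * n + 1) * ((2 * n) choose n))"
    by (metis Suc_eq_plus1 mult_cancel1 nat.simps(3))
  hence 3: "of_nat (n + 1) * (of_nat ((2 * n + 2) choose (n + 1)) :: rat)
      = 2 * (of_nat (2 * n + 1) * of_nat ((2 * n) choose n))"
    by (metis of_nat_mult of_nat_numeral)
  show ?thesis
    using 3 by (simp add: catalan_gf_def field_simps del: of_nat_Suc binomial_Suc_Suc of_nat_add)
qed

(* C(x) = (1 - sqrt(1 - 4x)) / (2x): the series 1 - 2x C(x) is the square root of 1 - 4x with
   constant term 1. *)
lemma catalan_gf_closed_form:
  defines "S \<equiv> 1 - 2 * fps_X * catalan_gf"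
  shows "S ^ 2 = 1 - 4 * fps_X" and "fps_nth S 0 = 1"
proof -
  show S0: "fps_nth S 0 = 1"
    by (simp add: S_def mult.assoc)
  have X4: "(4 :: rat fps) = fps_const 4" "(2 :: rat fps) = fps_const 2"
    by (simp_all add: numeral_fps_const)
  have SS: "fps_nth S (Suc n) = - 2 * fps_nth catalan_gf n" for n
    by (simp add: S_def X4 mult.assoc)
  have ode: "(1 - 4 * fps_X) * fps_deriv S = - 2 * S"
  proof (rule fps_ext)
    fix n
    show "fps_nth ((1 - 4 * fps_X) * fps_deriv S) n = fps_nth (- 2 * S) n"
    proof (cases n)
      case 0
      thus ?thesis
        by (simp add: left_diff_distrib SS S0 catalan_gf_def mult.assoc)
    next
      case (Suc k)
      have "fps_nth ((1 - 4 * fps_X) * fps_deriv S) n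
          = fps_nth (fps_deriv S) n - 4 * fps_nth (fps_X * fps_deriv S) n"
        by (simp add: left_diff_distrib mult.assoc X4)
      also have "\<dots> = - 2 * fps_nth S n"
        using catalan_gf_Suc[of k] by (simp add: Suc SS algebra_simps)
      also have "\<dots> = fps_nth (- 2 * S) n"
        by (simp add: X4)
      finally show ?thesis .
    qed
  qed
  define Q where "Q = S ^ 2"
  have odeQ: "(1 - 4 * fps_X) * fps_deriv Q = - 4 * Q"
  proof -
    have "fps_deriv Q = 2 * S * fps_deriv S"
      by (simp add: Q_def power2_eq_square algebra_simps)
    hence "(1 - 4 * fps_X) * fps_deriv Q = 2 * S * ((1 - 4 * fps_X) * fps_deriv S)"
      by (simp add: mult_ac)
    thus ?thesis by (simp add: ode Q_def power2_eq_square)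
  qed
  have Q0: "fps_nth Q 0 = 1"
    by (simp add: Q_def S0 power2_eq_square)
  have rec: "of_nat (Suc n) * fps_nth Q (Suc n) = (4 * of_nat n - 4) * fps_nth Q n" for n
  proof -
    have "fps_nth ((1 - 4 * fps_X) * fps_deriv Q) n
        = fps_nth (fps_deriv Q) n - 4 * fps_nth (fps_X * fps_deriv Q) n"
      by (simp add: left_diff_distrib mult.assoc X4)
    moreover have "fps_nth (- 4 * Q) n = - 4 * fps_nth Q n"
      by (simp add: X4)
    moreover have "fps_nth (fps_X * fps_deriv Q) n = of_nat n * fps_nth Q n"
      by (cases n) simp_all
    moreover have "fps_nth (fps_deriv Q) n = of_nat (Suc n) * fps_nth Q (Suc n)"
      by simp
    ultimately have "of_nat (Suc n) * fps_nth Q (Suc n) - 4 * (of_nat n * fps_nth Q n)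
        = - 4 * fps_nth Q n"
      using odeQ by (simp only:)
    thus ?thesis
      by (simp add: algebra_simps)
  qed
  have Q1: "fps_nth Q (Suc 0) = - 4"
    using rec[of 0] Q0 by simp
  have Q2: "fps_nth Q (Suc (Suc n)) = 0" for n
  proof (induction n)
    case 0
    thus ?case using rec[of 1] by simp
  next
    case (Suc n)
    have "of_nat (Suc (Suc (Suc n))) * fps_nth Q (Suc (Suc (Suc n))) = (0 :: rat)"
      using rec[of "Suc (Suc n)"] Suc by simp
    thus ?case by (metis mult_eq_0_iff nat.simps(3) of_nat_eq_0_iff)
  qed
  have "Q = 1 - 4 * fps_X"
  proof (rule fps_ext)
    fix n
    consider "n = 0" | "n = Suc 0" | k where "n = Suc (Suc k)"
      by (metis not0_implies_Suc)
    thus "fps_nth Q n = fps_nth (1 - 4 * fps_X) n"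
      by cases (simp_all add: Q0 Q1 Q2 X4)
  qed
  thus "S ^ 2 = 1 - 4 * fps_X"
    by (simp add: Q_def)
qed

end

theory Submission
  imports Defs "HOL-Library.Sublist"
begin

text \<open>
  A pass ends prematurely exactly when the next value \<open>k + 1\<close> lies below the top of the stack, that
  is, when \<open>k + 1\<close> precedes \<open>k\<close> in the input with a larger value between them. Hence the tier counts
  the values \<open>k\<close> that are separated from \<open>k + 1\<close> in this sense.

  Inserting a new minimum into a permutation whose minimum has (one-based) position \<open>p\<close>, with \<open>g\<close>
  entries in front of it, creates a new separated value iff \<open>g > p\<close>. With a catalytic variable \<open>q\<close>
  for the position of the minimum this is a linear recurrence, and the kernel method at
  \<open>q = C((1 - w) y)\<close> turns it into \<open>T(y) = q - 1 + w q T(y q)\<close>. Iterating this from \<open>y = z\<close> produces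
  the successive \<open>\<rho>\<^sub>j\<close>, with a remainder divisible by a growing power of \<open>w\<close>.
\<close>

section \<open>Separated values and the effect of deleting the minimum\<close>

definition separated :: "nat list \<Rightarrow> nat \<Rightarrow> bool" where
  "separated xs k \<longleftrightarrow> (\<exists>x > Suc k. subseq [Suc k, x, k] xs)"

definition sep_count :: "nat list \<Rightarrow> nat" where
  "sep_count xs = card {k. separated xs k}"

lemma subseq_imp_subset: "subseq xs ys \<Longrightarrow> set xs \<subseteq> set ys"
  by (induction rule: list_emb.induct) auto

lemma separated_imp_mem: "separated xs k \<Longrightarrow> k \<in> set xs"
  unfolding separated_def by (auto dest: subseq_imp_subset)

lemma finite_separated: "finite {k. separated xs k}"
  by (rule finite_subset[of _ "set xs"]) (auto dest: separated_imp_mem)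

lemma subseq_remove_middle:
  assumes "m \<notin> set zs" "m \<notin> set as" "m \<notin> set bs"
  shows "subseq zs (as @ m # bs) \<longleftrightarrow> subseq zs (as @ bs)"
proof
  assume "subseq zs (as @ m # bs)"
  then have "subseq (filter (\<lambda>x. x \<noteq> m) zs) (filter (\<lambda>x. x \<noteq> m) (as @ m # bs))"
    by (rule subseq_filter)
  moreover have "filter (\<lambda>x. x \<noteq> m) ys = ys" if "m \<notin> set ys" for ys
    using that by (auto simp: filter_id_conv)
  ultimately show "subseq zs (as @ bs)" using assms by simp
next
  assume "subseq zs (as @ bs)"
  moreover have "subseq (as @ bs) (as @ m # bs)"
    by (simp add: subseq_append' list_emb_Cons)
  ultimately show "subseq zs (as @ m # bs)"
    by (rule subseq_order.order_trans)
qed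

text \<open>All entries of \<open>as\<close> exceed \<open>m\<close>, so if \<open>Suc m\<close>
  occurs there but not last, the last entry of \<open>as\<close> can serve as the larger value in
  between. If \<open>Suc m\<close> is last, nothing stands between it and \<open>m\<close>.\<close>

lemma separated_min_iff:
  assumes "m \<notin> set as" "m \<notin> set bs" "distinct as" "\<forall>x\<in>set as. m < x"
  shows "separated (as @ m # bs) m \<longleftrightarrow> Suc m \<in> set as \<and> last as \<noteq> Suc m"
proof
  assume "separated (as @ m # bs) m"
  then obtain x where x: "x > Suc m" "subseq [Suc m, x, m] (as @ m # bs)"
    by (auto simp: separated_def)
  obtain xs1 xs2 where split: "[Suc m, x, m] = xs1 @ xs2" "subseq xs1 as" "subseq xs2 (m # bs)"
    using x(2) by (rule subseq_appendE)
  have "m \<notin> set xs1"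
    using subseq_imp_subset[OF split(2)] assms(1) by auto
  \<comment> \<open>A part starting with \<open>y \<noteq> m\<close> would have to embed in
    \<open>bs\<close>, which does not contain \<open>m\<close>. Hence the pattern splits exactly
    before its \<open>m\<close>.\<close>
  moreover have "\<not> subseq (y # ys) (m # bs)" if "m \<in> set ys" "y \<noteq> m" for y ys
    using that assms(2) subseq_imp_subset[of "y # ys" bs] by auto
  ultimately have sub: "subseq [Suc m, x] as"
    using split x(1) by (auto simp: Cons_eq_append_conv)
  have "last as \<noteq> Suc m"
  proof
    assume "last as = Suc m"
    moreover have "as \<noteq> []" using sub by auto
    ultimately obtain us where as: "as = us @ [Suc m]"
      by (metis append_butlast_last_id)
    obtain xs1 xs2 where "[Suc m, x] = xs1 @ xs2" "subseq xs1 us" "subseq xs2 [Suc m]"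
      using sub unfolding as by (rule subseq_appendE)
    moreover have "Suc m \<notin> set us" using assms(3) as by simp
    ultimately show False
      using x(1) subseq_imp_subset[of xs1 us] by (auto simp: Cons_eq_append_conv split: if_splits)
  qed
  then show "Suc m \<in> set as \<and> last as \<noteq> Suc m"
    using subseq_imp_subset[OF sub] by simp
next
  assume a: "Suc m \<in> set as \<and> last as \<noteq> Suc m"
  then obtain us vs where as: "as = us @ Suc m # vs"
    by (meson split_list)
  with a have "vs \<noteq> []" by auto
  then obtain ws x where vs: "vs = ws @ [x]"
    by (metis rev_exhaust)
  have "x > Suc m"
    using assms(3,4) unfolding as vs by (auto intro!: Suc_lessI)
  moreover have "subseq [Suc m, x, m] (as @ m # bs)"
    unfolding as vs by (auto intro!: list_emb_append2)
  ultimately show "separated (as @ m # bs) m"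
    by (auto simp: separated_def)
qed

text \<open>For \<open>k > m\<close> the pattern of \<open>k\<close> uses only values above
  \<open>m\<close>, so deleting \<open>m\<close> does not affect it. Values below \<open>m\<close>
  do not occur, and only the status of \<open>m\<close> itself can be lost.\<close>

lemma sep_count_remove_min:
  assumes "m \<notin> set as" "m \<notin> set bs" "\<forall>x\<in>set (as @ bs). m < x"
  shows "sep_count (as @ m # bs) = sep_count (as @ bs) + of_bool (separated (as @ m # bs) m)"
proof -
  have "separated (as @ m # bs) k \<longleftrightarrow> separated (as @ bs) k" if "k \<noteq> m" for k
  proof (cases "k < m")
    case True
    have "k \<notin> set (as @ m # bs)" using True assms(3)[rule_format, of k] by auto
    moreover have "k \<notin> set (as @ bs)" using True assms(3)[rule_format, of k] by auto
    ultimately show ?thesis using separated_imp_mem by blast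
  next
    case False
    with that show ?thesis
      unfolding separated_def using assms
      by (intro ex_cong1 conj_cong refl subseq_remove_middle) auto
  qed
  moreover have "\<not> separated (as @ bs) m"
    using assms by (auto dest: separated_imp_mem)
  ultimately have "{k. separated (as @ m # bs) k} = (if separated (as @ m # bs) m
      then insert m {k. separated (as @ bs) k} else {k. separated (as @ bs) k})"
    by (smt (verit) Collect_cong insert_Collect)
  with \<open>\<not> separated (as @ bs) m\<close> show ?thesis
    unfolding sep_count_def by (simp add: finite_separated)
qed

lemma sep_count_map_Suc: "sep_count (map Suc xs) = sep_count xs"
proof -
  have sub: "subseq (map Suc zs) (map Suc xs) \<longleftrightarrow> subseq zs xs" for zs
    using subseq_map[of "map Suc zs" "map Suc xs" "\<lambda>x. x - 1"] 
    by (auto simp: subseq_map o_def)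
  have "separated (map Suc xs) k \<longleftrightarrow> (\<exists>j. k = Suc j \<and> separated xs j)" for k
  proof (cases k)
    case 0
    then show ?thesis using separated_imp_mem by fastforce
  next
    case (Suc j)
    have "separated (map Suc xs) (Suc j) \<longleftrightarrow>
        (\<exists>x>Suc j. subseq [Suc (Suc j), Suc x, Suc j] (map Suc xs))"
      unfolding separated_def by (metis Suc_less_eq Suc_less_eq2)
    also have "\<dots> \<longleftrightarrow> separated xs j"
      unfolding separated_def by (simp flip: sub)
    finally show ?thesis using Suc by simp
  qed
  then have "{k. separated (map Suc xs) k} = Suc ` {k. separated xs k}"
    by auto
  then show ?thesis
    by (simp add: sep_count_def card_image)
qed

section \<open>Each pass that leaves a remainder consumes one separated value\<close>

lemma pop_all_le: "pop_all st m = (st', m') \<Longrightarrow> m \<le> m'"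
  by (induction st m rule: pop_all.induct) (auto split: if_splits)

text \<open>The list \<open>rev st @ xs\<close> holds the values not yet output in their original
  order. A run of pops loses a separated value only at its end: the last value popped,
  \<open>m' - 1\<close>, is separated iff \<open>m'\<close> is buried in the stack.\<close>

lemma pop_all_invariant:
  assumes "pop_all st m = (st', m')" "distinct (rev st @ xs)" "set (rev st @ xs) = {m..<N}"
  shows "distinct (rev st' @ xs) \<and> set (rev st' @ xs) = {m'..<N} \<and>
    (st' = [] \<or> hd st' \<noteq> m') \<and>
    rev st' @ xs = filter (\<lambda>x. m' \<le> x) (rev st @ xs) \<and>
    sep_count (rev st @ xs) = sep_count (rev st' @ xs) +
      of_bool (st \<noteq> [] \<and> hd st = m \<and> m' \<in> set st')"
  using assms
proof (induction st m rule: pop_all.induct)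
  case (1 m)
  then show ?case by (auto simp: filter_id_conv)
next
  case (2 x st m)
  show ?case
  proof (cases "x = m")
    case False
    then have eq: "st' = x # st" "m' = m" using 2(2) by auto
    have "filter (\<lambda>x. m \<le> x) (rev (x # st) @ xs) = rev (x # st) @ xs"
      using 2(4) by (intro filter_True) auto
    then show ?thesis
      using 2(3,4) False unfolding eq by simp
  next
    case True
    have mem: "m \<notin> set (rev st)" "m \<notin> set xs" "\<forall>x\<in>set (rev st @ xs). m < x"
      "distinct (rev st @ xs)" "m < N"
      using 2(3,4) True by (auto simp: set_eq_iff less_le)
    have set: "set (rev st @ xs) = {Suc m..<N}"
    proof -
      have "set (rev st @ xs) = set (rev (x # st) @ xs) - {m}"
        using mem(1,2) True by auto
      also have "\<dots> = {m..<N} - {m}" unfolding 2(4) ..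
      also have "\<dots> = {Suc m..<N}" by auto
      finally show ?thesis .
    qed
    have pop: "pop_all st (Suc m) = (st', m')"
      using 2(2) True by simp
    note IH = 2(1)[OF True pop mem(4) set]
    have sep: "separated (rev st @ m # xs) m \<longleftrightarrow> Suc m \<in> set st \<and> hd st \<noteq> Suc m"
      using mem by (subst separated_min_iff) (auto simp: last_rev)
    have rm: "sep_count (rev st @ m # xs) = sep_count (rev st @ xs) +
        of_bool (Suc m \<in> set st \<and> hd st \<noteq> Suc m)"
      using sep_count_remove_min[of m "rev st" xs] mem sep by simp
    have nop: "st' = st \<and> m' = Suc m" if "st = [] \<or> hd st \<noteq> Suc m"
      using that pop by (cases st) auto
    have I: "distinct (rev st' @ xs)" "set (rev st' @ xs) = {m'..<N}" "st' = [] \<or> hd st' \<noteq> m'"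
      "rev st' @ xs = filter (\<lambda>x. m' \<le> x) (rev st @ xs)"
      "sep_count (rev st @ xs) = sep_count (rev st' @ xs) +
        of_bool (st \<noteq> [] \<and> hd st = Suc m \<and> m' \<in> set st')"
      using IH by blast+
    have "rev st' @ xs = filter (\<lambda>x. m' \<le> x) (rev (x # st) @ xs)"
      unfolding I(4) using pop_all_le[OF pop] True by simp
    \<comment> \<open>If \<open>Suc m\<close> is on top, the run goes on and \<open>m\<close> is not
      separated. Otherwise the run stops with \<open>m' = Suc m\<close>, and \<open>m\<close> is
      separated iff \<open>Suc m\<close> lies deeper in the stack.\<close>
    moreover have "of_bool (st \<noteq> [] \<and> hd st = Suc m \<and> m' \<in> set st') +
        of_bool (Suc m \<in> set st \<and> hd st \<noteq> Suc m) = (of_bool (m' \<in> set st') :: nat)"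
    proof (cases "st = [] \<or> hd st \<noteq> Suc m")
      case True
      then show ?thesis using nop by auto
    qed simp
    then have "sep_count (rev (x # st) @ xs) = sep_count (rev st' @ xs) +
        of_bool (x # st \<noteq> [] \<and> hd (x # st) = m \<and> m' \<in> set st')"
      using rm I(5) True by simp
    ultimately show ?thesis
      using I(1-3) by (intro conjI) auto
  qed
qed

text \<open>Once \<open>m\<close> is buried in the stack, nothing more is popped in this pass. Hence
  a pass loses its one separated value at the moment when the next value to output is first found
  buried, and none if the stack ends up empty.\<close>

lemma push_all_invariant:
  assumes "push_all xs st m = (st', m')" "distinct (rev st @ xs)" "set (rev st @ xs) = {m..<N}"
    "st = [] \<or> hd st \<noteq> m"
  shows "rev st' = filter (\<lambda>x. m' \<le> x) (rev st @ xs) \<and> set st' = {m'..<N} \<and> m \<le> m' \<and>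
    (m \<in> set st \<longrightarrow> m' = m) \<and> (m \<in> set xs \<longrightarrow> m < m') \<and>
    sep_count (rev st @ xs) = sep_count (rev st') + of_bool (m \<notin> set st \<and> st' \<noteq> [])"
  using assms
proof (induction xs arbitrary: st m)
  case Nil
  then have eq: "st' = st" "m' = m" by auto
  have "filter (\<lambda>x. m \<le> x) (rev st) = rev st"
    using Nil.prems(3) by (intro filter_True) auto
  \<comment> \<open>With no input left, the smallest value not yet output can only be in the
    stack.\<close>
  moreover have "m \<in> set st" if "st \<noteq> []"
    using that Nil.prems(3) by (metis atLeastLessThan_empty_iff append_Nil2 atLeastLessThan_iff
        le_refl set_empty set_rev)
  ultimately show ?case
    using Nil.prems(3) unfolding eq by auto
next
  case (Cons x xs)
  obtain st1 m1 where pop: "pop_all (x # st) m = (st1, m1)"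
    by fastforce
  have push: "push_all xs st1 m1 = (st', m')"
    using Cons.prems(1) pop by simp
  have P: "distinct (rev st1 @ xs) \<and> set (rev st1 @ xs) = {m1..<N} \<and>
    (st1 = [] \<or> hd st1 \<noteq> m1) \<and>
    rev st1 @ xs = filter (\<lambda>x. m1 \<le> x) (rev st @ x # xs) \<and>
    sep_count (rev st @ x # xs) = sep_count (rev st1 @ xs) + of_bool (x = m \<and> m1 \<in> set st1)"
  proof -
    have pre: "distinct (rev (x # st) @ xs)" "set (rev (x # st) @ xs) = {m..<N}"
      using Cons.prems(2,3) by auto
    have hd: "x # st \<noteq> [] \<and> hd (x # st) = m \<and> m1 \<in> set st1 \<longleftrightarrow> x = m \<and> m1 \<in> set st1"
      by simp
    have rev: "rev (x # st) @ xs = rev st @ x # xs"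
      by simp
    show ?thesis
      using pop_all_invariant[OF pop pre] unfolding hd rev .
  qed
  have I: "rev st' = filter (\<lambda>x. m' \<le> x) (rev st1 @ xs) \<and> set st' = {m'..<N} \<and> m1 \<le> m' \<and>
    (m1 \<in> set st1 \<longrightarrow> m' = m1) \<and> (m1 \<in> set xs \<longrightarrow> m1 < m') \<and>
    sep_count (rev st1 @ xs) = sep_count (rev st') + of_bool (m1 \<notin> set st1 \<and> st' \<noteq> [])"
    using P by (intro Cons.IH[OF push]) blast+
  have filt: "rev st' = filter (\<lambda>x. m' \<le> x) (rev st @ x # xs)"
  proof -
    have "rev st' = filter (\<lambda>x. m' \<le> x) (filter (\<lambda>x. m1 \<le> x) (rev st @ x # xs))"
      using I P by metis
    also have "\<dots> = filter (\<lambda>x. m' \<le> x) (rev st @ x # xs)"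
      unfolding filter_filter using I by (intro filter_cong) auto
    finally show ?thesis .
  qed
  have I': "set st' = {m'..<N}" "m1 \<le> m'" "m1 \<in> set st1 \<longrightarrow> m' = m1" "m1 \<in> set xs \<longrightarrow> m1 < m'"
    "sep_count (rev st1 @ xs) = sep_count (rev st') + of_bool (m1 \<notin> set st1 \<and> st' \<noteq> [])"
    using I by blast+
  have P': "sep_count (rev st @ x # xs) = sep_count (rev st1 @ xs) + of_bool (x = m \<and> m1 \<in> set st1)"
    "set (rev st1 @ xs) = {m1..<N}"
    using P by blast+
  show ?case
  proof (cases "x = m")
    case False
    then have eq: "st1 = x # st" "m1 = m" using pop by auto
    have mem: "m \<in> set (x # st) \<longleftrightarrow> m \<in> set st" "m \<in> set (x # xs) \<longleftrightarrow> m \<in> set xs"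
      using False by auto
    have "sep_count (rev st @ x # xs) = sep_count (rev st1 @ xs)"
      using P'(1) False by simp
    from trans[OF this I'(5)] show ?thesis
      using filt I'(1-4) unfolding eq mem by (intro conjI) argo+
  next
    case True
    then have m: "m \<notin> set st" using Cons.prems(2) by auto
    have m1: "m < m1"
      using pop_all_le[of st "Suc m" st1 m1] pop True by simp
    have count: "sep_count (rev st @ x # xs) = sep_count (rev st') + of_bool (st' \<noteq> [])"
    \<comment> \<open>Either the pass gets blocked by this very run of pops, which then accounts for
      the loss, or the loss is the one counted by the induction hypothesis.\<close>
    proof (cases "m1 \<in> set st1")
      case True
      then have "m' \<in> set st'" using I'(1,3) P'(2) by auto
      then have "st' \<noteq> []" by auto
      then show ?thesis using True \<open>x = m\<close> I'(5) P'(1) by simp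
    next
      case False
      then show ?thesis using I'(5) P'(1) by simp
    qed
    show ?thesis
      using I'(1,2) filt m m1 count by simp
  qed
qed

text \<open>The stack starts empty, so \<open>m\<close> is not buried and the previous invariant
  charges exactly one separated value unless the pass finishes. The returned input is the stack read
  from bottom to top.\<close>

lemma sort_pass_step:
  assumes "distinct xs" "set xs = {m..<N}" "xs \<noteq> []"
  obtains ys m' where "sort_pass (xs, m) = (ys, m')" "distinct ys" "set ys = {m'..<N}" "m < m'"
    "sep_count xs = sep_count ys + of_bool (ys \<noteq> [])"
proof -
  obtain st m' where push: "push_all xs [] m = (st, m')"
    by fastforce
  have m: "m \<in> set xs"
    using assms(2,3) by (metis atLeastLessThan_empty_iff atLeastLessThan_iff le_refl set_empty)
  have I: "rev st = filter (\<lambda>x. m' \<le> x) xs" "set st = {m'..<N}" "m < m'"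
    "sep_count xs = sep_count (rev st) + of_bool (st \<noteq> [])"
    using push_all_invariant[OF push, of N] assms m by auto
  have "filter (\<lambda>x. x \<in> set st) xs = rev st"
    unfolding I(1) using I(2) assms by (intro filter_cong) auto
  then have pass: "sort_pass (xs, m) = (rev st, m')"
    by (simp add: sort_pass_def push)
  have dist: "distinct (rev st)"
    unfolding I(1) using assms(1) by simp
  have set: "set (rev st) = {m'..<N}"
    using I(2) by simp
  have "sep_count xs = sep_count (rev st) + of_bool (rev st \<noteq> [])"
    unfolding rev_is_Nil_conv by (rule I(4))
  with pass dist set I(3) show ?thesis
    by (rule that)
qed

lemma sort_pass_Nil: "sort_pass ([], m) = ([], m)"
  by (simp add: sort_pass_def)

text \<open>Every pass but the final one lowers \<open>sep_count\<close> by one, and the final one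
  starts from \<open>sep_count\<close> zero. So \<open>sep_count xs + 1\<close> passes are
  needed.\<close>

lemma passes_eq_Nil_iff:
  assumes "distinct xs" "set xs = {m..<N}" "xs \<noteq> []"
  shows "fst ((sort_pass ^^ k) (xs, m)) = [] \<longleftrightarrow> sep_count xs < k"
  using assms
proof (induction k arbitrary: xs m)
  case 0
  then show ?case by simp
next
  case (Suc k)
  obtain ys m' where step: "sort_pass (xs, m) = (ys, m')" "distinct ys" "set ys = {m'..<N}"
      "sep_count xs = sep_count ys + of_bool (ys \<noteq> [])"
    using sort_pass_step[OF Suc.prems] by metis
  have *: "(sort_pass ^^ Suc k) (xs, m) = (sort_pass ^^ k) (ys, m')"
    by (simp only: funpow_Suc_right o_apply step(1))
  show ?case
  proof (cases "ys = []")
    case True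
    have "(sort_pass ^^ k) ([], m') = ([], m')"
      by (induction k) (simp_all add: sort_pass_Nil)
    moreover have "sep_count [] = 0"
      by (simp add: sep_count_def separated_def)
    ultimately show ?thesis using * step(4) True by simp
  next
    case False
    then show ?thesis using * step(4) Suc.IH[OF step(2,3)] by simp
  qed
qed

lemma tier_eq_sep_count:
  assumes "p \<in> permutations_of_set {1..n}" "n \<ge> 1"
  shows "tier p = sep_count p"
proof -
  have "distinct p" "set p = {1..<Suc n}" "p \<noteq> []"
    using assms by (auto dest: permutations_of_setD)
  then have "passes_needed p = (LEAST k. sep_count p < k)"
    unfolding passes_needed_def by (simp add: passes_eq_Nil_iff)
  also have "\<dots> = Suc (sep_count p)"
    by (rule Least_equality) auto
  finally show ?thesis by (simp add: tier_def)
qed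

section \<open>Building permutations by inserting a new minimum\<close>

definition pos :: "'a \<Rightarrow> 'a list \<Rightarrow> nat" where
  "pos m xs = length (takeWhile (\<lambda>x. x \<noteq> m) xs)"

definition insert_at :: "nat \<Rightarrow> 'a \<Rightarrow> 'a list \<Rightarrow> 'a list" where
  "insert_at g m ys = take g ys @ m # drop g ys"

lemma pos_append_Cons: "m \<notin> set us \<Longrightarrow> pos m (us @ m # vs) = length us"
  unfolding pos_def by (subst takeWhile_append2) auto

lemma pos_less_length: "m \<in> set xs \<Longrightarrow> pos m xs < length xs"
  by (auto dest!: split_list_first simp: pos_append_Cons)

lemma pos_insert_at: "m \<notin> set ys \<Longrightarrow> g \<le> length ys \<Longrightarrow> pos m (insert_at g m ys) = g"
  unfolding insert_at_def by (subst pos_append_Cons) (auto dest: in_set_takeD)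

lemma remove1_insert_at: "m \<notin> set ys \<Longrightarrow> remove1 m (insert_at g m ys) = ys"
  unfolding insert_at_def by (simp add: remove1_append) (auto dest: in_set_takeD)

lemma insert_at_pos: "m \<in> set xs \<Longrightarrow> distinct xs \<Longrightarrow> insert_at (pos m xs) m (remove1 m xs) = xs"
  by (auto dest!: split_list simp: pos_append_Cons insert_at_def remove1_append)

text \<open>Deleting \<open>m\<close> and recording its position inverts the insertion.\<close>

lemma sum_permutations_insert_at:
  fixes f :: "'a list \<Rightarrow> 'b :: comm_monoid_add"
  assumes "finite A" "m \<notin> A"
  shows "(\<Sum>xs\<in>permutations_of_set (insert m A). f xs) =
    (\<Sum>ys\<in>permutations_of_set A. \<Sum>g\<le>card A. f (insert_at g m ys))"
proof -
  have "(\<Sum>ys\<in>permutations_of_set A. \<Sum>g\<le>card A. f (insert_at g m ys)) =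
      (\<Sum>(ys, g)\<in>permutations_of_set A \<times> {..card A}. f (insert_at g m ys))"
    by (rule sum.cartesian_product)
  also have "\<dots> = (\<Sum>xs\<in>permutations_of_set (insert m A). f xs)"
  proof (rule sum.reindex_bij_witness[of _ "\<lambda>xs. (remove1 m xs, pos m xs)"
        "\<lambda>(ys, g). insert_at g m ys"])
    fix p assume "p \<in> permutations_of_set A \<times> {..card A}"
    then obtain ys g where p: "p = (ys, g)" "ys \<in> permutations_of_set A" "g \<le> card A"
      by auto
    then have ys: "set ys = A" "distinct ys" "g \<le> length ys"
      by (simp_all add: permutations_of_setD length_finite_permutations_of_set)
    show "(remove1 m (case p of (ys, g) \<Rightarrow> insert_at g m ys),
        pos m (case p of (ys, g) \<Rightarrow> insert_at g m ys)) = p"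
      using assms ys p(1) by (simp add: remove1_insert_at pos_insert_at)
    have "set (take g ys) \<union> set (drop g ys) = A"
      using ys by (simp flip: set_append)
    moreover have "distinct (take g ys @ drop g ys)"
      unfolding append_take_drop_id by (rule ys(2))
    ultimately show "(case p of (ys, g) \<Rightarrow> insert_at g m ys) \<in> permutations_of_set (insert m A)"
      using assms(2) p(1) unfolding distinct_append by (auto simp: insert_at_def permutations_of_set_def)
    show "f (case p of (ys, g) \<Rightarrow> insert_at g m ys) = (case p of (ys, g) \<Rightarrow> f (insert_at g m ys))"
      by (simp add: p)
  next
    fix xs assume "xs \<in> permutations_of_set (insert m A)"
    then have xs: "set xs = insert m A" "distinct xs"
      by (auto dest: permutations_of_setD)
    then show "(case (remove1 m xs, pos m xs) of (ys, g) \<Rightarrow> insert_at g m ys) = xs"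
      by (simp add: insert_at_pos)
    have "length (remove1 m xs) = card A" 
      using xs assms by (simp add: length_remove1 distinct_card[symmetric])
    moreover have "pos m xs \<le> length (remove1 m xs)"
    proof -
      have "pos m xs < length xs"
        using xs(1) by (simp add: pos_less_length)
      then show ?thesis using xs(1) by (simp add: length_remove1)
    qed
    ultimately show "(remove1 m xs, pos m xs) \<in> permutations_of_set A \<times> {..card A}"
      using xs assms by (auto simp: permutations_of_set_def set_remove1_eq)
  qed
  finally show ?thesis ..
qed

text \<open>By \<open>separated_min_iff\<close>, the prefix of length \<open>g\<close> must contain
  \<open>Suc m\<close> and reach beyond it. As \<open>pos\<close> counts from zero,
  \<open>Suc (pos (Suc m) ys)\<close> is the length of the prefix ending in
  \<open>Suc m\<close>.\<close>

lemma sep_count_insert_at: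
  assumes "Suc m \<in> set ys" "distinct ys" "\<forall>y\<in>set ys. m < y" "g \<le> length ys"
  shows "sep_count (insert_at g m ys) = sep_count ys + of_bool (Suc (pos (Suc m) ys) < g)"
proof -
  obtain us vs where ys: "ys = us @ Suc m # vs"
    using assms(1) by (meson split_list)
  then have notin: "Suc m \<notin> set us" "Suc m \<notin> set vs"
    using assms(2) by auto
  have m: "m \<notin> set ys" using assms(3) by auto
  have take_sub: "set (take g ys) \<subseteq> set ys" "set (drop g ys) \<subseteq> set ys"
    by (auto dest: in_set_takeD in_set_dropD)
  have "Suc m \<in> set (take g ys) \<and> last (take g ys) \<noteq> Suc m \<longleftrightarrow> Suc (length us) < g"
  proof (cases "g \<le> length us")
    case True
    then have "take g ys = take g us" by (simp add: ys)
    then show ?thesis using True notin by (auto dest: in_set_takeD)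
  next
    case False
    \<comment> \<open>Here \<open>d\<close> is how far the prefix reaches beyond
      \<open>Suc m\<close>.\<close>
    then obtain d where g: "g = Suc (length us + d)"
      by (metis add.commute add_Suc_right less_natE not_le)
    then have take: "take g ys = us @ Suc m # take d vs" by (simp add: ys)
    show ?thesis
    proof (cases d)
      case 0
      then show ?thesis using g take by simp
    next
      case (Suc e)
      have "vs \<noteq> []" using assms(4) g Suc by (auto simp: ys)
      then have ne: "take d vs \<noteq> []" using Suc by simp
      then have "last (take g ys) \<in> set (take d vs)"
        using take by simp
      then have "last (take g ys) \<in> set vs"
        by (rule in_set_takeD)
      then show ?thesis using notin take g Suc by auto
    qed
  qed
  moreover have "separated (insert_at g m ys) m \<longleftrightarrow>
      Suc m \<in> set (take g ys) \<and> last (take g ys) \<noteq> Suc m"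
    unfolding insert_at_def using m take_sub assms(2,3) by (intro separated_min_iff) auto
  moreover have "sep_count (insert_at g m ys) = sep_count ys + of_bool (separated (insert_at g m ys) m)"
  proof -
    have "m \<notin> set (take g ys)" "m \<notin> set (drop g ys)"
      using m take_sub by auto
    then show ?thesis
      using sep_count_remove_min[of m "take g ys" "drop g ys"] assms(3)
      by (simp add: insert_at_def flip: set_append)
  qed
  moreover have "pos (Suc m) ys = length us"
    unfolding ys by (rule pos_append_Cons[OF notin(1)])
  ultimately show ?thesis by simp
qed

section \<open>Recurrence in the position of the minimum, and the kernel method\<close>

text \<open>The variable \<open>q\<close> marks the one-based position of the minimum. Both
  \<open>w\<close> and \<open>q\<close> are arbitrary ring elements, so that a power series can be
  substituted for \<open>q\<close> later.\<close>

definition perm_gf :: "'a::comm_ring_1 \<Rightarrow> 'a \<Rightarrow> nat \<Rightarrow> nat \<Rightarrow> 'a" where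
  "perm_gf w q m n =
    (\<Sum>xs\<in>permutations_of_set {m..<m + n}. w ^ sep_count xs * q ^ Suc (pos m xs))"

text \<open>Inserting \<open>m\<close> starts from permutations of values from \<open>Suc m\<close>
  on; this shift brings the recurrence back to the same base.\<close>

lemma perm_gf_Suc_left: "perm_gf w q (Suc m) n = perm_gf w q m n"
proof -
  have pos: "pos (Suc m) (map Suc xs) = pos m xs" for xs
    by (simp add: pos_def takeWhile_map o_def)
  have "map Suc ` permutations_of_set {m..<m + n} = permutations_of_set {Suc m..<Suc m + n}"
  proof (intro equalityI subsetI)
    fix ys assume ys: "ys \<in> permutations_of_set {Suc m..<Suc m + n}"
    have "Suc (y - 1) = y" if "y \<in> set ys" for y
      using that permutations_of_setD(1)[OF ys] by simp
    then have "map Suc (map (\<lambda>x. x - 1) ys) = ys"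
      by (simp add: map_idI)
    moreover have "map (\<lambda>x. x - 1) ys \<in> permutations_of_set {m..<m + n}"
    proof
      have "set ys = Suc ` {m..<m + n}"
        using ys by (simp add: permutations_of_set_def image_Suc_atLeastLessThan)
      then show "set (map (\<lambda>x. x - 1) ys) = {m..<m + n}"
        unfolding set_map by (simp only: image_image diff_Suc_1 image_ident)
      show "distinct (map (\<lambda>x. x - 1) ys)"
        using ys by (auto simp: permutations_of_set_def distinct_map inj_on_def)
    qed
    ultimately show "ys \<in> map Suc ` permutations_of_set {m..<m + n}"
      by (metis image_eqI)
  qed (auto simp: permutations_of_set_def distinct_map image_Suc_atLeastLessThan)
  then show ?thesis
    unfolding perm_gf_def
    by (intro sum.reindex_cong[of "map Suc"] inj_on_subset[OF inj_mapI[OF inj_Suc] subset_UNIV])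
      (simp_all add: pos sep_count_map_Suc)
qed

lemma perm_gf_Suc_0: "perm_gf w q m (Suc 0) = q"
proof -
  have "sep_count [m] = 0"
    by (auto simp: sep_count_def separated_def)
  then show ?thesis
    by (simp add: perm_gf_def pos_def)
qed

text \<open>Two geometric sums, split at \<open>g = p\<close>; the factor \<open>1 - q\<close>
  avoids a division.\<close>

lemma sum_of_bool_power:
  fixes q w :: "'a :: comm_ring_1"
  assumes "p \<le> N"
  shows "(1 - q) * (\<Sum>g\<le>N. w ^ of_bool (p < g) * q ^ Suc g) =
    q - (1 - w) * q ^ (p + 2) - w * q ^ (N + 2)"
  using assms
proof (induction N rule: dec_induct)
  case base
  have "(1 - q) * (\<Sum>g\<le>p. w ^ of_bool (p < g) * q ^ Suc g) = (1 - q) * (q * (\<Sum>g\<le>p. q ^ g))"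
    by (simp add: sum_distrib_left)
  also have "\<dots> = q * ((1 - q) * (\<Sum>g\<le>p. q ^ g))" by (simp add: mult_ac)
  also have "\<dots> = q * (1 - q ^ Suc p)" by (simp only: sum_gp_basic)
  finally show ?case by (simp add: algebra_simps)
next
  case (step N)
  then show ?case by (simp add: algebra_simps)
qed

text \<open>Sums \<open>sum_of_bool_power\<close> over all old permutations, with \<open>p\<close>
  the one-based position of the old minimum. The terms free of \<open>p\<close> yield
  \<open>perm_gf w 1\<close>, and \<open>q ^ (p + 2)\<close> yields \<open>q\<^sup>2\<close> times
  \<open>perm_gf w q\<close>.\<close>

lemma perm_gf_rec:
  "(1 - q) * perm_gf w q m (Suc (Suc n)) =
    q * perm_gf w 1 m (Suc n) - (1 - w) * q\<^sup>2 * perm_gf w q m (Suc n)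
      - w * q ^ (n + 3) * perm_gf w 1 m (Suc n)"
proof -
  let ?A = "{Suc m..<Suc m + Suc n}"
  have ins: "insert m ?A = {m..<m + Suc (Suc n)}" by auto
  have "(1 - q) * perm_gf w q m (Suc (Suc n)) =
      (1 - q) * (\<Sum>ys\<in>permutations_of_set ?A. \<Sum>g\<le>Suc n.
        w ^ sep_count (insert_at g m ys) * q ^ Suc (pos m (insert_at g m ys)))"
    unfolding perm_gf_def ins[symmetric] by (subst sum_permutations_insert_at) auto
  also have "\<dots> = (\<Sum>ys\<in>permutations_of_set ?A. w ^ sep_count ys *
      ((1 - q) * (\<Sum>g\<le>Suc n. w ^ of_bool (Suc (pos (Suc m) ys) < g) * q ^ Suc g)))"
    unfolding sum_distrib_left
  proof (intro sum.cong refl)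
    fix ys g assume "ys \<in> permutations_of_set ?A" "g \<in> {..Suc n}"
    then have ys: "set ys = ?A" "distinct ys" "g \<le> length ys"
      by (simp_all add: permutations_of_setD length_finite_permutations_of_set)
    then have "sep_count (insert_at g m ys) = sep_count ys + of_bool (Suc (pos (Suc m) ys) < g)"
      by (intro sep_count_insert_at) auto
    moreover have "pos m (insert_at g m ys) = g"
      using ys by (intro pos_insert_at) auto
    ultimately show "(1 - q) * (w ^ sep_count (insert_at g m ys) * q ^ Suc (pos m (insert_at g m ys))) =
        w ^ sep_count ys * ((1 - q) * (w ^ of_bool (Suc (pos (Suc m) ys) < g) * q ^ Suc g))"
      by (simp only: power_add) (simp only: mult_ac)
  qed
  \<comment> \<open>The powers of \<open>1\<close> are kept so that the sums match
    \<open>perm_gf w 1\<close> literally.\<close>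
  also have "\<dots> = (\<Sum>ys\<in>permutations_of_set ?A. q * (w ^ sep_count ys * 1 ^ Suc (pos (Suc m) ys))
      - (1 - w) * q\<^sup>2 * (w ^ sep_count ys * q ^ Suc (pos (Suc m) ys))
      - w * q ^ (n + 3) * (w ^ sep_count ys * 1 ^ Suc (pos (Suc m) ys)))"
  proof (intro sum.cong refl)
    fix ys assume "ys \<in> permutations_of_set ?A"
    then have ys: "set ys = ?A" "length ys = Suc n"
      by (simp_all add: permutations_of_setD length_finite_permutations_of_set)
    have "pos (Suc m) ys < length ys"
      using ys(1) by (intro pos_less_length) simp
    then have "(1 - q) * (\<Sum>g\<le>Suc n. w ^ of_bool (Suc (pos (Suc m) ys) < g) * q ^ Suc g) =
        q - (1 - w) * q ^ (Suc (pos (Suc m) ys) + 2) - w * q ^ (Suc n + 2)"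
      using ys by (intro sum_of_bool_power) auto
    then show "w ^ sep_count ys *
        ((1 - q) * (\<Sum>g\<le>Suc n. w ^ of_bool (Suc (pos (Suc m) ys) < g) * q ^ Suc g)) =
      q * (w ^ sep_count ys * 1 ^ Suc (pos (Suc m) ys))
      - (1 - w) * q\<^sup>2 * (w ^ sep_count ys * q ^ Suc (pos (Suc m) ys))
      - w * q ^ (n + 3) * (w ^ sep_count ys * 1 ^ Suc (pos (Suc m) ys))"
      by (simp only:) (simp add: algebra_simps power2_eq_square numeral_eq_Suc)
  qed
  also have "\<dots> = q * perm_gf w 1 (Suc m) (Suc n) - (1 - w) * q\<^sup>2 * perm_gf w q (Suc m) (Suc n)
      - w * q ^ (n + 3) * perm_gf w 1 (Suc m) (Suc n)"
    unfolding perm_gf_def sum_subtractf sum_distrib_left ..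
  finally show ?thesis
    unfolding perm_gf_Suc_left .
qed


text \<open>The equation for \<open>q\<close> turns \<open>1 - q\<close> into
  \<open>- (1 - w) * y * q\<^sup>2\<close>. After cancelling \<open>q\<close>, the two values of
  \<open>perm_gf w q\<close> in the recurrence become consecutive terms of a telescoping
  sum.\<close>

lemma perm_gf_step:
  fixes q w y :: "'a :: idom"
  assumes "q = 1 + (1 - w) * y * q\<^sup>2" "q \<noteq> 0"
  shows "(1 - w) * q * (y ^ Suc n * perm_gf w q m (Suc n) -
      y ^ Suc (Suc n) * perm_gf w q m (Suc (Suc n))) =
    perm_gf w 1 m (Suc n) * y ^ Suc n - w * q * (perm_gf w 1 m (Suc n) * (y * q) ^ Suc n)"
proof -
  define F F' T where "F = perm_gf w q m (Suc n)" and "F' = perm_gf w q m (Suc (Suc n))"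
    and "T = perm_gf w 1 m (Suc n)"
  have "- ((1 - w) * y * q\<^sup>2) * F' = (1 - q) * F'"
    by (subst (2) assms(1)) simp
  also have "\<dots> = q * T - (1 - w) * q\<^sup>2 * F - w * q ^ (n + 3) * T"
    unfolding F_def F'_def T_def by (rule perm_gf_rec)
  finally have "q * (- ((1 - w) * y * q) * F') = q * (T - (1 - w) * q * F - w * q ^ (n + 2) * T)"
    by (simp add: algebra_simps power2_eq_square numeral_eq_Suc)
  then have "- ((1 - w) * y * q) * F' = T - (1 - w) * q * F - w * q ^ (n + 2) * T"
    by (simp only: mult_cancel_left assms(2) simp_thms)
  then have eq: "(1 - w) * q * F - (1 - w) * y * q * F' = T - w * q ^ (n + 2) * T"
    by (simp add: algebra_simps)
  have "(1 - w) * q * (y ^ Suc n * F - y ^ Suc (Suc n) * F') =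
      y ^ Suc n * ((1 - w) * q * F - (1 - w) * y * q * F')"
    by (simp add: algebra_simps)
  also have "\<dots> = y ^ Suc n * (T - w * q ^ (n + 2) * T)"
    unfolding eq ..
  also have "\<dots> = T * y ^ Suc n - w * q * (T * (y * q) ^ Suc n)"
    by (simp add: algebra_simps power_mult_distrib)
  finally show ?thesis
    unfolding F_def F'_def T_def .
qed

text \<open>The choice of \<open>q\<close> makes the kernel of the recurrence telescope, so that \<open>perm_gf w q\<close>
  survives only in a remainder of order \<open>N + 1\<close> in \<open>y\<close>.\<close>

lemma perm_gf_kernel:
  fixes q w y :: "'a :: idom"
  assumes "q = 1 + (1 - w) * y * q\<^sup>2" "q \<noteq> 0"
  shows "(\<Sum>n=1..N. perm_gf w 1 m n * y ^ n) =
    q - 1 + w * q * (\<Sum>n=1..N. perm_gf w 1 m n * (y * q) ^ n)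
      - (1 - w) * q * (y ^ Suc N * perm_gf w q m (Suc N))"
proof (induction N)
  case 0
  \<comment> \<open>Both sums are empty and \<open>perm_gf w q m 1 = q\<close>, so this is the
    equation for \<open>q\<close> itself.\<close>
  show ?case
    using assms(1) by (simp add: perm_gf_Suc_0 power2_eq_square algebra_simps)
next
  case (Suc N)
  have eq: "c = d + (x * a - x * b)" if "x * (a - b) = c - d" for x a b c d :: 'a
    using that by (simp add: algebra_simps)
  have "(\<Sum>n=1..Suc N. perm_gf w 1 m n * y ^ n) =
      (\<Sum>n=1..N. perm_gf w 1 m n * y ^ n) + perm_gf w 1 m (Suc N) * y ^ Suc N"
    by simp
  also have "\<dots> = q - 1 + w * q * (\<Sum>n=1..Suc N. perm_gf w 1 m n * (y * q) ^ n)
      - (1 - w) * q * (y ^ Suc (Suc N) * perm_gf w q m (Suc (Suc N)))"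
    unfolding Suc.IH eq[OF perm_gf_step[OF assms, of N m]]
    by (simp add: distrib_left del: power_Suc)
  finally show ?case .
qed

section \<open>From finite sums to the power series \<open>tier_gf\<close>\<close>

lemma fps_const_sum: "fps_const (sum f A) = (\<Sum>x\<in>A. fps_const (f x))"
  by (induction A rule: infinite_finite_induct) (simp_all flip: fps_const_add)

text \<open>Setting \<open>q = 1\<close> forgets the position. The case \<open>n = 0\<close>
  differs, because \<open>tier_gf\<close> leaves out the empty permutation.\<close>

lemma perm_gf_eq_tier_gf:
  assumes "n \<ge> 1"
  shows "perm_gf var_w 1 1 n = fps_const (fps_nth tier_gf n)"
proof -
  have "{1..<1 + n} = {1..n}" by auto
  then have "perm_gf var_w 1 1 n = (\<Sum>xs\<in>permutations_of_set {1..n}. fps_const (fps_X ^ tier xs))"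
    unfolding perm_gf_def using assms
    by (intro sum.cong) (auto simp: tier_eq_sep_count fps_const_power)
  also have "\<dots> = fps_const (\<Sum>xs\<in>permutations_of_set {1..n}. fps_X ^ tier xs)"
    by (simp add: fps_const_sum)
  also have "(\<Sum>xs\<in>permutations_of_set {1..n}. fps_X ^ tier xs) = fps_nth tier_gf n"
  proof (rule fps_ext)
    fix t
    have "fps_nth (\<Sum>xs\<in>permutations_of_set {1..n}. fps_X ^ tier xs :: rat fps) t =
        (\<Sum>xs\<in>permutations_of_set {1..n}. if tier xs = t then 1 else 0)"
      by (auto simp: fps_sum_nth intro!: sum.cong)
    then show "fps_nth (\<Sum>xs\<in>permutations_of_set {1..n}. fps_X ^ tier xs :: rat fps) t =
        fps_nth (fps_nth tier_gf n) t"
      using assms by (simp add: tier_gf_def tier_count_def sum.If_cases Int_def)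
  qed
  finally show ?thesis .
qed

text \<open>Powers \<open>y ^ n\<close> with \<open>n > N\<close> start beyond order
  \<open>N\<close>, so a truncated sum suffices.\<close>

lemma fps_compose_nth_le:
  fixes F y :: "'a :: comm_ring_1 fps"
  assumes "fps_nth y 0 = 0" "k \<le> N"
  shows "fps_nth (F oo y) k = fps_nth (\<Sum>n=0..N. fps_const (fps_nth F n) * y ^ n) k"
proof -
  have "fps_nth (F oo y) k = (\<Sum>n=0..k. fps_nth F n * fps_nth (y ^ n) k)"
    by (simp add: fps_compose_nth)
  also have "\<dots> = (\<Sum>n=0..N. fps_nth F n * fps_nth (y ^ n) k)"
    using assms by (intro sum.mono_neutral_left) (auto simp: startsby_zero_power_prefix)
  finally show ?thesis by (simp add: fps_sum_nth)
qed

lemma tier_gf_compose_nth: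
  assumes "fps_nth y 0 = 0" "k \<le> N"
  shows "fps_nth (tier_gf oo y) k = fps_nth (\<Sum>n=1..N. perm_gf var_w 1 1 n * y ^ n) k"
proof -
  have "(\<Sum>n=0..N. fps_const (fps_nth tier_gf n) * y ^ n) = (\<Sum>n=1..N. perm_gf var_w 1 1 n * y ^ n)"
  proof (rule sum.mono_neutral_cong_right)
    have "fps_nth tier_gf 0 = 0" by (simp add: tier_gf_def)
    then show "\<forall>n\<in>{0..N} - {1..N}. fps_const (fps_nth tier_gf n) * y ^ n = 0"
      by (auto simp: not_le)
  qed (simp_all add: perm_gf_eq_tier_gf del: One_nat_def)
  then show ?thesis
    using fps_compose_nth_le[OF assms] by simp
qed

text \<open>The coefficient of order \<open>N\<close> is read off from \<open>perm_gf_kernel\<close>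
  truncated at the same \<open>N\<close>: its remainder contains \<open>y ^ Suc N\<close> and
  contributes nothing there.\<close>

lemma tier_gf_functional_equation:
  assumes y: "fps_nth y 0 = 0" and q: "q = 1 + (1 - var_w) * y * q\<^sup>2"
  shows "tier_gf oo y = q - 1 + var_w * q * (tier_gf oo (y * q))"
proof (rule fps_ext)
  fix N
  define S where "S z = (\<Sum>n=1..N. perm_gf var_w 1 1 n * z ^ n)" for z :: "rat fps fps"
  have "fps_nth q 0 = 1"
    by (subst q) (simp add: y)
  then have "q \<noteq> 0" by auto
  have "fps_nth (y ^ Suc N * perm_gf var_w q 1 (Suc N)) i = 0" if "i \<le> N" for i
    using that y by (auto simp: fps_mult_nth startsby_zero_power_prefix intro!: sum.neutral simp del: power_Suc)
  then have "fps_nth ((1 - var_w) * q * (y ^ Suc N * perm_gf var_w q 1 (Suc N))) N = 0"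
    by (subst fps_mult_nth) simp
  \<comment> \<open>A product's coefficient of order \<open>N\<close> involves only orders up to
    \<open>N\<close> of the factor, where composition and truncation agree.\<close>
  moreover have "fps_nth (var_w * q * (tier_gf oo (y * q))) N = fps_nth (var_w * q * S (y * q)) N"
    unfolding S_def fps_mult_nth[of "var_w * q"]
    by (intro sum.cong refl) (use y in \<open>simp add: tier_gf_compose_nth[of "y * q" _ N]\<close>)
  moreover have "fps_nth (tier_gf oo y) N = fps_nth (S y) N"
    unfolding S_def using y by (intro tier_gf_compose_nth) auto
  moreover have "S y = q - 1 + var_w * q * S (y * q)
      - (1 - var_w) * q * (y ^ Suc N * perm_gf var_w q 1 (Suc N))"
    unfolding S_def by (rule perm_gf_kernel[OF q \<open>q \<noteq> 0\<close>])
  ultimately show "fps_nth (tier_gf oo y) N =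
      fps_nth (q - 1 + var_w * q * (tier_gf oo (y * q))) N"
    by simp
qed

section \<open>Catalan series and iteration of the functional equation\<close>

lemma catalan_gf_quadratic: "catalan_gf = 1 + fps_X * catalan_gf\<^sup>2"
proof -
  have "(1 - 2 * fps_X * catalan_gf)\<^sup>2 = 1 - 4 * fps_X"
    by (rule catalan_gf_closed_form)
  then have "4 * fps_X * (1 + fps_X * catalan_gf\<^sup>2 - catalan_gf) = 0"
    by (simp add: power2_eq_square algebra_simps)
  then show ?thesis by simp
qed

text \<open>The quadratic equation passes to \<open>D\<close>, whose coefficients are constants in
  \<open>w\<close>, and then through composition with \<open>f\<close>, which respects sums and
  products as \<open>f\<close> has no constant term.\<close>

lemma catalan_subst_quadratic:
  assumes "fps_nth f 0 = 0"
  shows "catalan_subst f = 1 + f * (catalan_subst f)\<^sup>2"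
proof -
  define D :: "rat fps fps" where "D = Abs_fps (\<lambda>n. fps_const (fps_nth catalan_gf n))"
  have "D = 1 + fps_X * D\<^sup>2"
  proof (rule fps_ext)
    fix n
    show "fps_nth D n = fps_nth (1 + fps_X * D\<^sup>2) n"
    proof (cases n)
      case 0
      then show ?thesis by (simp add: D_def catalan_gf_def)
    next
      case (Suc k)
      have "fps_nth D n = fps_const (fps_nth (1 + fps_X * catalan_gf\<^sup>2) n)"
        by (simp add: D_def flip: catalan_gf_quadratic)
      also have "\<dots> = fps_const (fps_nth (catalan_gf\<^sup>2) k)"
        by (simp add: Suc)
      also have "\<dots> = fps_nth (D\<^sup>2) k"
        by (simp add: D_def fps_const_sum power2_eq_square fps_mult_nth)
      finally show ?thesis by (simp add: Suc)
    qed
  qed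
  then have "D oo f = (1 + fps_X * D\<^sup>2) oo f" by simp
  also have "\<dots> = 1 + f * (D oo f)\<^sup>2"
    using assms by (simp add: fps_compose_add_distrib fps_compose_mult_distrib power2_eq_square)
  finally show ?thesis
    by (simp add: catalan_subst_def D_def)
qed

text \<open>This is the kernel equation for \<open>q = rho j\<close> at
  \<open>y = var_z * (\<Prod>i<j. rho i)\<close>.\<close>

lemma rho_quadratic: "rho j = 1 + (1 - var_w) * (var_z * (\<Prod>i<j. rho i)) * (rho j)\<^sup>2"
proof -
  have "rho j = catalan_subst (var_z * (1 - var_w) * (\<Prod>i<j. rho i))"
    by (rule rho.simps)
  then show ?thesis
    using catalan_subst_quadratic[of "var_z * (1 - var_w) * (\<Prod>i<j. rho i)"]
    by (simp add: mult_ac)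
qed

text \<open>Each step applies the functional equation to the remainder; there \<open>y * q\<close>
  is the argument with \<open>rho k\<close> added to the product.\<close>

lemma tier_gf_expansion:
  "tier_gf = (\<Sum>j<k. (rho j - 1) * var_w ^ j * (\<Prod>i<j. rho i)) +
    var_w ^ k * (\<Prod>i<k. rho i) * (tier_gf oo (var_z * (\<Prod>i<k. rho i)))"
proof (induction k)
  case 0
  show ?case by simp
next
  case (Suc k)
  have "tier_gf oo (var_z * (\<Prod>i<k. rho i)) =
      rho k - 1 + var_w * rho k * (tier_gf oo (var_z * (\<Prod>i<k. rho i) * rho k))"
    by (rule tier_gf_functional_equation[OF _ rho_quadratic]) simp
  moreover have "var_z * (\<Prod>i<k. rho i) * rho k = var_z * (\<Prod>i<Suc k. rho i)"
    by (simp add: mult_ac)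
  ultimately have step: "tier_gf oo (var_z * (\<Prod>i<k. rho i)) =
      rho k - 1 + var_w * rho k * (tier_gf oo (var_z * (\<Prod>i<Suc k. rho i)))"
    by simp
  show ?case
    by (subst Suc, subst step) (simp add: algebra_simps)
qed

theorem theorem4p11:
  shows "\<forall>n. (\<lambda>j. fps_nth ((rho j - 1) * var_w ^ j * (\<Prod>i<j. rho i)) n) sums fps_nth tier_gf n"
proof (intro allI)
  fix n
  \<comment> \<open>The remainder after \<open>k\<close> terms is divisible by
    \<open>var_w ^ k\<close>, so the coefficient of \<open>w ^ m\<close> is final once
    \<open>k > m\<close>. This is convergence in the \<open>w\<close>-adic topology.\<close>
  have "fps_nth (\<Sum>j<k. fps_nth ((rho j - 1) * var_w ^ j * (\<Prod>i<j. rho i)) n) m =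
      fps_nth (fps_nth tier_gf n) m" if "k > m" for k m
  proof -
    define R where "R = (\<Prod>i<k. rho i) * (tier_gf oo (var_z * (\<Prod>i<k. rho i)))"
    have "fps_nth tier_gf n = (\<Sum>j<k. fps_nth ((rho j - 1) * var_w ^ j * (\<Prod>i<j. rho i)) n) +
        fps_nth (var_w ^ k * R) n"
      by (subst tier_gf_expansion[of k]) (simp add: fps_sum_nth R_def mult.assoc)
    moreover have "fps_nth (fps_nth (var_w ^ k * R) n) m = 0"
      using that by (simp add: fps_const_power fps_X_power_mult_nth)
    ultimately show ?thesis by simp
  qed
  then show "(\<lambda>j. fps_nth ((rho j - 1) * var_w ^ j * (\<Prod>i<j. rho i)) n) sums fps_nth tier_gf n"
    unfolding sums_def
    by (intro tendsto_fpsI) (auto intro: eventually_mono[OF eventually_gt_at_top])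
qed

end
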